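(* Let $(X,d,A)$ be a metric pair with $A\neq\emptyset$. Let $T:\mathrm{Lip}(X,A)\to\mathbb{R}$ be a sequentially order continuous positive linear functional that is exhausted by compact sets. Then there is a unique $1$-finite relative Radon measure $\mu\in\mathcal{M}_1^+(X,A)$ such that $T(f)=\int_X f\,d\mu$ for all $f\in\mathrm{Lip}(X,A)$.
   Context: A metric pair $(X,d,A)$ is a metric space $(X,d)$ with a closed subset $A\subset X$; $d_A(x)=\inf_{a\in A}d(x,a)$. Measures take values in $[0,\infty]$. Let $\mathcal{B}^+(X)$ be the commutative monoid of Borel measures on $X$ and $\mathcal{B}^+(X,A)=\mathcal{B}^+(X)/\mathcal{B}^+(A)$ the quotient monoid: $\mu\sim\nu$ iff $\mu+\sigma=\nu+\tau$ for some Borel measures $\sigma,\tau$ concentrated on $A$; equivalently $\mu,\nu$ agree on Borel subsets of $X\setminus A$, so relative Borel measures correspond bijectively to Borel measures on $X\setminus A$. For $f$ vanishing on $A$, $\mu(f)=\int_X f\,d\mu=\int_{X\setminus A}f\,d\mu$ is well defined. $\mu\in\mathcal{B}^+(X,A)$ is tight if $\mu(E)=\sup\{\mu(K): K\subset E \text{ compact}\}$ for every Borel $E\subset X\setminus A$. $\mathcal{M}_1^+(X,A)$ is the set of tight $\mu\in\mathcal{B}^+(X,A)$ that are $1$-finite, i.e. $\mu(d_A)<\infty$. $\mathrm{Lip}(X,A)$ is the vector space of Lipschitz functions $f:X\to\mathbb{R}$ with $f|_A=0$, a Riesz space (vector lattice) under the pointwise order; $\mathrm{Lip}^+(X,A)$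 is its set of nonnegative elements. A linear functional is positive if it is nonnegative on $\mathrm{Lip}^+(X,A)$. In a Riesz space $E$, $x_n\xrightarrow{o}0$ means there is a decreasing sequence $(y_n)$ in $E$ with infimum $0$ in $E$ and $|x_n|\le y_n$ for all $n$; a linear functional $T$ is sequentially order continuous if $x_n\xrightarrow{o}0$ implies $T(x_n)\to0$. A positive linear functional $T$ on $\mathrm{Lip}(X,A)$ is exhausted by compact sets if for all $f\in\mathrm{Lip}^+(X,A)$ and all $\varepsilon>0$ there is a compact set $K\subset X\setminus A$ such that $\sup\{T(g): g\in\mathrm{Lip}^+(X,A),\ g|_K=0,\ g\le f\}<\varepsilon$. *)

theory Defs
  imports "HOL-Analysis.Analysis" "HOL-Library.Lub_Glb"
begin

section \<open>Relative Borel measures\<close>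

definition borel_measures :: "'a::topological_space measure set" where
  "borel_measures = {\<mu>. sets \<mu> = sets borel}"

definition concentrated_on :: "'a::topological_space set \<Rightarrow> 'a measure \<Rightarrow> bool" where
  "concentrated_on A \<sigma> \<longleftrightarrow> \<sigma> \<in> borel_measures \<and> emeasure \<sigma> (- A) = 0"

text \<open>The type of measures carries no addition, so the identity \<open>\<mu> + \<sigma> = \<nu> + \<tau>\<close> is
  spelled out on Borel sets.\<close>

definition rel_borel_equiv :: "'a::topological_space set \<Rightarrow> ('a measure \<times> 'a measure) set" where
  "rel_borel_equiv A = {(\<mu>, \<nu>). \<mu> \<in> borel_measures \<and> \<nu> \<in> borel_measures \<and>
     (\<exists>\<sigma> \<tau>. concentrated_on A \<sigma> \<and> concentrated_on A \<tau> \<and>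
       (\<forall>E\<in>sets borel. emeasure \<mu> E + emeasure \<sigma> E = emeasure \<nu> E + emeasure \<tau> E))}"

definition rel_borel_measures :: "'a::topological_space set \<Rightarrow> 'a measure set set" where
  "rel_borel_measures A = borel_measures // rel_borel_equiv A"

text \<open>The next three operations take the common value over all representatives of a class. They are
  meaningful only for Borel sets disjoint from \<open>A\<close> and Borel functions vanishing on \<open>A\<close>; see the
  lemmas \<open>rel_emeasure_eq\<close>, \<open>rel_nn_integral_eq\<close> and \<open>rel_integral_eq\<close> below.\<close>

definition rel_emeasure :: "'a measure set \<Rightarrow> 'a set \<Rightarrow> ennreal" where
  "rel_emeasure M E = the_elem ((\<lambda>\<mu>. emeasure \<mu> E) ` M)"

definition rel_nn_integral :: "'a measure set \<Rightarrow> ('a \<Rightarrow> ennreal) \<Rightarrow> ennreal" where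
  "rel_nn_integral M f = the_elem ((\<lambda>\<mu>. \<integral>\<^sup>+x. f x \<partial>\<mu>) ` M)"

definition rel_integral :: "'a measure set \<Rightarrow> ('a \<Rightarrow> real) \<Rightarrow> real" where
  "rel_integral M f = the_elem ((\<lambda>\<mu>. \<integral>x. f x \<partial>\<mu>) ` M)"

definition tight :: "'a::topological_space set \<Rightarrow> 'a measure set \<Rightarrow> bool" where
  "tight A M \<longleftrightarrow> (\<forall>E\<in>sets borel. E \<subseteq> - A \<longrightarrow>
     rel_emeasure M E = (SUP K\<in>{K. compact K \<and> K \<subseteq> E}. rel_emeasure M K))"

text \<open>\<^term>\<open>infdist x A\<close> is \<open>d\<^sub>A(x)\<close> for nonempty \<open>A\<close>; for empty \<open>A\<close> the library sets it to \<open>0\<close>.\<close>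

definition one_finite :: "'a::metric_space set \<Rightarrow> 'a measure set \<Rightarrow> bool" where
  "one_finite A M \<longleftrightarrow> rel_nn_integral M (\<lambda>x. ennreal (infdist x A)) < \<infinity>"

definition M1_plus :: "'a::metric_space set \<Rightarrow> 'a measure set set" where
  "M1_plus A = {M \<in> rel_borel_measures A. tight A M \<and> one_finite A M}"


section \<open>Lipschitz functions and functionals on them\<close>

definition Lip :: "'a::metric_space set \<Rightarrow> ('a \<Rightarrow> real) set" where
  "Lip A = {f. (\<exists>L. L-lipschitz_on UNIV f) \<and> (\<forall>x\<in>A. f x = 0)}"

definition Lip_plus :: "'a::metric_space set \<Rightarrow> ('a \<Rightarrow> real) set" where
  "Lip_plus A = {f \<in> Lip A. \<forall>x. 0 \<le> f x}"

text \<open>Functionals are total functions on \<^typ>\<open>'a \<Rightarrow> real\<close>; their values outside the given space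
  \<open>V\<close> play no role.\<close>

definition linear_functional_on :: "('a \<Rightarrow> real) set \<Rightarrow> (('a \<Rightarrow> real) \<Rightarrow> real) \<Rightarrow> bool" where
  "linear_functional_on V T \<longleftrightarrow>
     (\<forall>f\<in>V. \<forall>g\<in>V. T (\<lambda>x. f x + g x) = T f + T g) \<and>
     (\<forall>c. \<forall>f\<in>V. T (\<lambda>x. c * f x) = c * T f)"

definition positive_linear_functional ::
    "'a::metric_space set \<Rightarrow> (('a \<Rightarrow> real) \<Rightarrow> real) \<Rightarrow> bool" where
  "positive_linear_functional A T \<longleftrightarrow>
     linear_functional_on (Lip A) T \<and> (\<forall>f\<in>Lip_plus A. 0 \<le> T f)"

text \<open>The infimum of the dominating sequence is taken in the Riesz space \<open>E\<close> of functions, which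
  is weaker than requiring pointwise convergence to \<open>0\<close>.\<close>

definition order_tends_to_zero :: "('a \<Rightarrow> real) set \<Rightarrow> (nat \<Rightarrow> 'a \<Rightarrow> real) \<Rightarrow> bool" where
  "order_tends_to_zero E x \<longleftrightarrow> (\<exists>y :: nat \<Rightarrow> 'a \<Rightarrow> real.
     range y \<subseteq> E \<and> decseq y \<and> isGlb E (range y) (\<lambda>_. 0) \<and>
     (\<forall>n. (\<lambda>t. \<bar>x n t\<bar>) \<le> y n))"

definition seq_order_continuous :: "('a \<Rightarrow> real) set \<Rightarrow> (('a \<Rightarrow> real) \<Rightarrow> real) \<Rightarrow> bool" where
  "seq_order_continuous E T \<longleftrightarrow>
     (\<forall>x. range x \<subseteq> E \<longrightarrow> order_tends_to_zero E x \<longrightarrow> (\<lambda>n. T (x n)) \<longlonglongrightarrow> 0)"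

text \<open>For a positive functional the set under \<open>Sup\<close> contains \<open>T 0 = 0\<close> and is bounded above by
  \<open>T f\<close>, so the supremum in the reals is the intended one.\<close>

definition exhausted_by_compacts ::
    "'a::metric_space set \<Rightarrow> (('a \<Rightarrow> real) \<Rightarrow> real) \<Rightarrow> bool" where
  "exhausted_by_compacts A T \<longleftrightarrow> (\<forall>f\<in>Lip_plus A. \<forall>\<epsilon>>0. \<exists>K. compact K \<and> K \<subseteq> - A \<and>
     Sup {T g | g. g \<in> Lip_plus A \<and> (\<forall>x\<in>K. g x = 0) \<and> g \<le> f} < \<epsilon>)"


section \<open>Well-definedness on classes\<close>

lemma rel_borel_equiv_iff:
  fixes A :: "'a::topological_space set"
  assumes A: "closed A"
  shows "(\<mu>, \<nu>) \<in> rel_borel_equiv A \<longleftrightarrow> \<mu> \<in> borel_measures \<and> \<nu> \<in> borel_measures \<and>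
    (\<forall>E\<in>sets borel. E \<subseteq> - A \<longrightarrow> emeasure \<mu> E = emeasure \<nu> E)"
proof (intro iffI conjI ballI impI)
  assume *: "(\<mu>, \<nu>) \<in> rel_borel_equiv A"
  show "\<mu> \<in> borel_measures" "\<nu> \<in> borel_measures"
    using * by (auto simp: rel_borel_equiv_def)
  fix E :: "'a set" assume E: "E \<in> sets borel" "E \<subseteq> - A"
  obtain \<sigma> \<tau> where st: "concentrated_on A \<sigma>" "concentrated_on A \<tau>"
      "\<forall>E\<in>sets borel. emeasure \<mu> E + emeasure \<sigma> E = emeasure \<nu> E + emeasure \<tau> E"
    using * by (auto simp: rel_borel_equiv_def)
  have "emeasure \<rho> E = 0" if "concentrated_on A \<rho>" for \<rho>
  proof -
    have "- A \<in> sets \<rho>"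
      using that A by (auto simp: concentrated_on_def borel_measures_def)
    then have "emeasure \<rho> E \<le> emeasure \<rho> (- A)"
      by (intro emeasure_mono E)
    then show ?thesis
      using that by (simp add: concentrated_on_def)
  qed
  then show "emeasure \<mu> E = emeasure \<nu> E"
    using st E by (metis add.right_neutral)
next
  assume *: "\<mu> \<in> borel_measures \<and> \<nu> \<in> borel_measures \<and>
    (\<forall>E\<in>sets borel. E \<subseteq> - A \<longrightarrow> emeasure \<mu> E = emeasure \<nu> E)"
  define R where "R \<rho> = density \<rho> (indicator A)" for \<rho> :: "'a measure"
  have Ab: "A \<in> sets borel" using A by simp
  have R: "emeasure (R \<rho>) E = emeasure \<rho> (A \<inter> E)"
    if "\<rho> \<in> borel_measures" "E \<in> sets borel" for \<rho> E
    using that Ab unfolding R_def borel_measures_def by (subst emeasure_restricted) auto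
  have conc: "concentrated_on A (R \<rho>)" if "\<rho> \<in> borel_measures" for \<rho>
    using that R[OF that, of "- A"] Ab
    by (auto simp: concentrated_on_def borel_measures_def R_def)
  have split: "emeasure \<rho> E = emeasure \<rho> (A \<inter> E) + emeasure \<rho> (E - A)"
    if "\<rho> \<in> borel_measures" "E \<in> sets borel" for \<rho> E
  proof -
    have "(A \<inter> E) \<union> (E - A) = E" by auto
    then show ?thesis
      using that Ab by (subst plus_emeasure) (auto simp: borel_measures_def)
  qed
  have "emeasure \<mu> E + emeasure (R \<nu>) E = emeasure \<nu> E + emeasure (R \<mu>) E"
    if E: "E \<in> sets borel" for E
  proof -
    have "emeasure \<mu> (E - A) = emeasure \<nu> (E - A)"
      using * E Ab by auto
    then show ?thesis
      using * E R split[of \<mu> E] split[of \<nu> E] by (simp add: ac_simps)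
  qed
  then show "(\<mu>, \<nu>) \<in> rel_borel_equiv A"
    using * conc unfolding rel_borel_equiv_def by blast
qed

lemma equiv_rel_borel_equiv:
  "closed A \<Longrightarrow> equiv borel_measures (rel_borel_equiv A)"
  by (auto intro!: equivI refl_onI symI transI simp: rel_borel_equiv_iff)

lemma rel_borel_measures_agree:
  assumes "closed A" "M \<in> rel_borel_measures A" "\<mu> \<in> M" "\<nu> \<in> M"
  shows "\<mu> \<in> borel_measures" "\<nu> \<in> borel_measures"
    "E \<in> sets borel \<Longrightarrow> E \<subseteq> - A \<Longrightarrow> emeasure \<mu> E = emeasure \<nu> E"
proof -
  have "(\<mu>, \<nu>) \<in> rel_borel_equiv A"
    using assms unfolding rel_borel_measures_def
    by (meson equiv_rel_borel_equiv quotient_eq_iff)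
  then show "\<mu> \<in> borel_measures" "\<nu> \<in> borel_measures"
    "E \<in> sets borel \<Longrightarrow> E \<subseteq> - A \<Longrightarrow> emeasure \<mu> E = emeasure \<nu> E"
    using assms(1) by (auto simp: rel_borel_equiv_iff)
qed

lemma rel_emeasure_eq:
  assumes "closed A" "M \<in> rel_borel_measures A" "\<mu> \<in> M" "E \<in> sets borel" "E \<subseteq> - A"
  shows "rel_emeasure M E = emeasure \<mu> E"
  unfolding rel_emeasure_def
proof (rule the_elem_image_unique)
  show "M \<noteq> {}" using assms(3) by auto
  show "emeasure \<nu> E = emeasure \<mu> E" if "\<nu> \<in> M" for \<nu>
    by (rule rel_borel_measures_agree(3)[OF assms(1,2) that assms(3-5)])
qed

lemma density_agree:
  assumes "closed A" "M \<in> rel_borel_measures A" "\<mu> \<in> M" "\<nu> \<in> M"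
  shows "density \<mu> (indicator (- A)) = density \<nu> (indicator (- A))"
proof (rule measure_eqI)
  note * = rel_borel_measures_agree[OF assms]
  show "sets (density \<mu> (indicator (- A))) = sets (density \<nu> (indicator (- A)))"
    using *(1,2) by (simp add: borel_measures_def)
  fix E assume "E \<in> sets (density \<mu> (indicator (- A)))"
  then have E: "E \<in> sets borel" using *(1) by (simp add: borel_measures_def)
  have "emeasure (density \<rho> (indicator (- A))) E = emeasure \<rho> (- A \<inter> E)"
    if "\<rho> \<in> borel_measures" for \<rho>
    using that E assms(1) unfolding borel_measures_def
    by (subst emeasure_restricted) auto
  then show "emeasure (density \<mu> (indicator (- A))) E = emeasure (density \<nu> (indicator (- A))) E"
    using * E assms(1) by auto
qed

lemma rel_nn_integral_eq:
  assumes "closed A" "M \<in> rel_borel_measures A" "\<mu> \<in> M"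
    "f \<in> borel_measurable borel" "\<And>x. x \<in> A \<Longrightarrow> f x = 0"
  shows "rel_nn_integral M f = (\<integral>\<^sup>+x. f x \<partial>\<mu>)"
proof -
  have eq: "(\<integral>\<^sup>+x. f x \<partial>\<rho>) = (\<integral>\<^sup>+x. f x \<partial>density \<rho> (indicator (- A)))" if "\<rho> \<in> M" for \<rho>
  proof -
    have "sets \<rho> = sets borel"
      using rel_borel_measures_agree(1)[OF assms(1,2) that that] by (simp add: borel_measures_def)
    have "- A \<in> sets \<rho>" "f \<in> borel_measurable \<rho>"
      using assms(1,4) \<open>sets \<rho> = sets borel\<close> by (auto cong: measurable_cong_sets)
    then have "(\<integral>\<^sup>+x. f x \<partial>density \<rho> (indicator (- A))) = (\<integral>\<^sup>+x. indicator (- A) x * f x \<partial>\<rho>)"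
      by (intro nn_integral_density) auto
    also have "\<dots> = (\<integral>\<^sup>+x. f x \<partial>\<rho>)"
      using assms(5) by (intro nn_integral_cong) (auto simp: indicator_def)
    finally show ?thesis by simp
  qed
  show ?thesis
    unfolding rel_nn_integral_def
  proof (rule the_elem_image_unique)
    show "M \<noteq> {}" using assms(3) by auto
    show "(\<integral>\<^sup>+x. f x \<partial>\<nu>) = (\<integral>\<^sup>+x. f x \<partial>\<mu>)" if "\<nu> \<in> M" for \<nu>
      unfolding eq[OF that] eq[OF assms(3)]
      by (simp only: density_agree[OF assms(1,2) that assms(3)])
  qed
qed

lemma rel_integral_eq:
  fixes f :: "'a::topological_space \<Rightarrow> real"
  assumes "closed A" "M \<in> rel_borel_measures A" "\<mu> \<in> M"
    "f \<in> borel_measurable borel" "\<And>x. x \<in> A \<Longrightarrow> f x = 0"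
  shows "rel_integral M f = (\<integral>x. f x \<partial>\<mu>)"
proof -
  have eq: "(\<integral>x. f x \<partial>\<rho>) = (\<integral>x. f x \<partial>density \<rho> (indicator (- A)))" if "\<rho> \<in> M" for \<rho>
  proof -
    have s: "sets \<rho> = sets borel"
      using rel_borel_measures_agree(1)[OF assms(1,2) that that] by (simp add: borel_measures_def)
    have m: "- A \<in> sets \<rho>" "f \<in> borel_measurable \<rho>"
      using assms(1,4) s by (auto cong: measurable_cong_sets)
    have "(\<lambda>x. ennreal (indicator (- A) x)) = (indicator (- A) :: 'a \<Rightarrow> ennreal)"
      by (auto simp: indicator_def)
    then have "(\<integral>x. f x \<partial>density \<rho> (indicator (- A)))
        = (\<integral>x. f x \<partial>density \<rho> (\<lambda>x. ennreal (indicator (- A) x)))"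
      by simp
    also have "\<dots> = (\<integral>x. indicator (- A) x *\<^sub>R f x \<partial>\<rho>)"
      using m by (intro integral_density) auto
    also have "\<dots> = (\<integral>x. f x \<partial>\<rho>)"
      using assms(5) by (intro Bochner_Integration.integral_cong) (auto simp: indicator_def)
    finally show ?thesis by simp
  qed
  show ?thesis
    unfolding rel_integral_def
  proof (rule the_elem_image_unique)
    show "M \<noteq> {}" using assms(3) by auto
    show "(\<integral>x. f x \<partial>\<nu>) = (\<integral>x. f x \<partial>\<mu>)" if "\<nu> \<in> M" for \<nu>
      unfolding eq[OF that] eq[OF assms(3)]
      by (simp only: density_agree[OF assms(1,2) that assms(3)])
  qed
qed

text \<open>So \<^const>\<open>rel_integral\<close> never returns the default value \<open>0\<close> of a non-integrable function
  when applied to a 1-finite measure and a function in \<open>Lip A\<close>.\<close>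

lemma Lip_integrable:
  assumes "closed A" "A \<noteq> {}" "M \<in> M1_plus A" "\<mu> \<in> M" "f \<in> Lip A"
  shows "integrable \<mu> f"
proof -
  have M: "M \<in> rel_borel_measures A" "one_finite A M"
    using assms(3) by (auto simp: M1_plus_def)
  have s: "sets \<mu> = sets borel"
    using rel_borel_measures_agree(1)[OF assms(1) M(1) assms(4,4)] by (simp add: borel_measures_def)
  obtain L where L: "L-lipschitz_on UNIV f" and f0: "\<And>x. x \<in> A \<Longrightarrow> f x = 0"
    using assms(5) by (auto simp: Lip_def)
  have "f \<in> borel_measurable borel" "(\<lambda>x. infdist x A) \<in> borel_measurable borel"
    using lipschitz_on_continuous_on[OF L]
    by (auto intro!: borel_measurable_continuous_onI continuous_intros)
  then have m: "f \<in> borel_measurable \<mu>" "(\<lambda>x. infdist x A) \<in> borel_measurable \<mu>"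
    using s by (auto cong: measurable_cong_sets)
  have "(\<integral>\<^sup>+x. ennreal (infdist x A) \<partial>\<mu>) < \<infinity>"
    using M(2) \<open>(\<lambda>x. infdist x A) \<in> borel_measurable borel\<close> unfolding one_finite_def
    by (subst (asm) rel_nn_integral_eq[OF assms(1) M(1) assms(4)]) auto
  then have "integrable \<mu> (\<lambda>x. infdist x A)"
    using m by (intro integrableI_nonneg) (auto simp: infdist_nonneg)
  then have int: "integrable \<mu> (\<lambda>x. L * infdist x A)"
    by simp
  have "\<bar>f x\<bar> \<le> L * infdist x A" for x
  proof -
    have bound: "\<bar>f x\<bar> \<le> L * dist x a" if "a \<in> A" for a
      using lipschitz_onD[OF L, of x a] f0[OF that] by (simp add: dist_real_def)
    have "\<bar>f x\<bar> \<le> L * infdist x A" if "L \<noteq> 0"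
    proof -
      have "0 < L" using lipschitz_on_nonneg[OF L] that by simp
      have "\<bar>f x\<bar> / L \<le> dist x a" if "a \<in> A" for a
        using bound[OF that] \<open>0 < L\<close> by (simp add: pos_divide_le_eq mult.commute)
      then have "\<bar>f x\<bar> / L \<le> infdist x A"
        unfolding infdist_notempty[OF assms(2)] using assms(2) by (intro cINF_greatest)
      then show ?thesis
        using \<open>0 < L\<close> by (simp add: pos_divide_le_eq mult.commute)
    qed
    moreover have "f x = 0" if "L = 0"
      using bound that assms(2) by fastforce
    ultimately show ?thesis by fastforce
  qed
  then show ?thesis
    by (intro Bochner_Integration.integrable_bound[OF int m(1)] AE_I2)
       (auto intro: order_trans[OF _ abs_ge_self])
qed

end

theory Submission
  imports Defs
begin

text \<open>Give an open set \<open>U\<close> the mass \<open>sup {T f | 0 \<le> f \<le> 1\<^sub>U}\<close>. Since \<open>T\<close> is continuous along sequences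
  decreasing pointwise to \<open>0\<close>, this mass is countably subadditive, and approximation by open sets
  from outside gives an outer measure for which open sets are Caratheodory measurable. Cutting \<open>f\<close> into
  horizontal layers of height \<open>\<delta>\<close>, each squeezed between \<open>\<delta>\<close> times the indicators of two consecutive
  superlevel sets, yields \<open>T f = \<integral>f d\<mu>\<close>. The sets \<open>{d\<^sub>A > c}\<close> have finite mass, so closed sets
  approximate Borel sets away from \<open>A\<close> from inside; exhaustion applied to a multiple of \<open>d\<^sub>A\<close> makes
  the approximating sets compact. The values \<open>T f\<close> determine the measure on open sets, hence on a
  compact set \<open>K = V - (V - K)\<close> with \<open>V\<close> open of finite mass, hence by tightness everywhere.\<close>

section \<open>The lattice of Lipschitz functions vanishing on a set\<close>

lemma Lip_add: "f \<in> Lip A \<Longrightarrow> g \<in> Lip A \<Longrightarrow> (\<lambda>x. f x + g x) \<in> Lip A"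
  unfolding Lip_def by (auto intro: lipschitz_on_add)

lemma Lip_cmult: "f \<in> Lip A \<Longrightarrow> (\<lambda>x. c * f x) \<in> Lip A"
  unfolding Lip_def by (auto intro: lipschitz_on_cmult_real)

lemma Lip_diff: "f \<in> Lip A \<Longrightarrow> g \<in> Lip A \<Longrightarrow> (\<lambda>x. f x - g x) \<in> Lip A"
  unfolding Lip_def by (auto intro: lipschitz_on_diff)

lemma Lip_zero: "(\<lambda>x. 0) \<in> Lip A"
  unfolding Lip_def by (auto intro: lipschitz_on_constant)

lemma Lip_sum: "(\<And>i. i \<in> I \<Longrightarrow> f i \<in> Lip A) \<Longrightarrow> (\<lambda>x. \<Sum>i\<in>I. f i x) \<in> Lip A"
  by (induction I rule: infinite_finite_induct) (auto intro: Lip_zero Lip_add)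

lemma lipschitz_on_min:
  fixes f g :: "'a::metric_space \<Rightarrow> real"
  assumes "L-lipschitz_on X f" "M-lipschitz_on X g"
  shows "(max L M)-lipschitz_on X (\<lambda>x. min (f x) (g x))"
proof (rule lipschitz_onI)
  show "0 \<le> max L M"
    using lipschitz_on_nonneg[OF assms(1)] by simp
  fix x y assume xy: "x \<in> X" "y \<in> X"
  have "\<bar>f x - f y\<bar> \<le> max L M * dist x y"
    using lipschitz_onD[OF assms(1) xy] mult_right_mono[of L "max L M" "dist x y"]
    by (simp add: dist_real_def)
  moreover have "\<bar>g x - g y\<bar> \<le> max L M * dist x y"
    using lipschitz_onD[OF assms(2) xy] mult_right_mono[of M "max L M" "dist x y"]
    by (simp add: dist_real_def)
  ultimately show "dist (min (f x) (g x)) (min (f y) (g y)) \<le> max L M * dist x y"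
    unfolding dist_real_def by linarith
qed

lemma Lip_min: "f \<in> Lip A \<Longrightarrow> g \<in> Lip A \<Longrightarrow> (\<lambda>x. min (f x) (g x)) \<in> Lip A"
  unfolding Lip_def by (auto intro: lipschitz_on_min)

text \<open>The sign of \<open>c\<close> keeps the values on \<open>A\<close> at
  \<open>min 0 c = 0\<close>. The case \<open>c = 0\<close> later splits a function into its
  positive and negative parts.\<close>

lemma Lip_min_const: "f \<in> Lip A \<Longrightarrow> 0 \<le> c \<Longrightarrow> (\<lambda>x. min (f x) c) \<in> Lip A"
  unfolding Lip_def by (auto intro: lipschitz_on_min[OF _ lipschitz_on_constant])

lemma Lip_infdist:
  assumes "A \<subseteq> C"
  shows "(\<lambda>x. infdist x C) \<in> Lip A"
proof -
  have "1-lipschitz_on UNIV (\<lambda>x. infdist x C)"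
    by (rule lipschitz_onI) (simp_all add: dist_real_def infdist_triangle_abs)
  then show ?thesis
    using assms unfolding Lip_def by auto
qed

lemma Lip_continuous_on: "f \<in> Lip A \<Longrightarrow> continuous_on UNIV f"
  unfolding Lip_def by (blast intro: lipschitz_on_continuous_on)

lemma Lip_borel_measurable:
  assumes "f \<in> Lip A"
  shows "f \<in> borel_measurable borel"
  using Lip_continuous_on[OF assms] by (rule borel_measurable_continuous_onI)

lemma Lip_open_gt:
  assumes "f \<in> Lip A"
  shows "open {x. c < f x}" "open {x. f x < c}"
  by (intro open_Collect_less continuous_on_const Lip_continuous_on[OF assms])+

text \<open>The distance is taken to \<open>A \<union> - U\<close>, so that bumps vanish on
  \<open>A\<close> as well as off \<open>U\<close>. For nonempty \<open>A\<close> this set is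
  nonempty even if \<open>U\<close> is the whole space, which avoids the default value
  \<open>0\<close> of \<open>infdist\<close> at the empty set.\<close>

definition bump :: "'a::metric_space set \<Rightarrow> 'a set \<Rightarrow> nat \<Rightarrow> 'a \<Rightarrow> real" where
  "bump A U k x = min (real k * infdist x (A \<union> - U)) 1"

lemma bump_Lip_plus: "bump A U k \<in> Lip_plus A"
proof -
  have "bump A U k \<in> Lip A"
    unfolding bump_def by (intro Lip_min_const Lip_cmult Lip_infdist) auto
  then show ?thesis
    by (simp add: Lip_plus_def bump_def infdist_nonneg)
qed

lemma bump_le_indicator: "bump A U k x \<le> indicator U x"
  by (auto simp: bump_def indicator_def)

lemma bump_mono: "k \<le> l \<Longrightarrow> bump A U k x \<le> bump A U l x"
  unfolding bump_def by (intro min.mono mult_right_mono) (auto simp: infdist_nonneg)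

text \<open>A point of \<open>U - A\<close> has positive distance to the closed set
  \<open>A \<union> - U\<close>, so a steep enough slope reaches the cap \<open>1\<close>. The bumps
  thus increase to the indicator of \<open>U - A\<close>.\<close>

lemma bump_eventually_1:
  assumes "closed A" "A \<noteq> {}" "open U" "x \<in> U" "x \<notin> A"
  shows "\<forall>\<^sub>F k in sequentially. bump A U k x = 1"
proof -
  have pos: "infdist x (A \<union> - U) > 0"
    using assms by (intro infdist_pos_not_in_closed) auto
  obtain n :: nat where n: "1 \<le> real n * infdist x (A \<union> - U)"
    using reals_Archimedean3[OF pos, rule_format, of 1] by (meson less_imp_le)
  have "bump A U k x = 1" if "n \<le> k" for k
    using order_trans[OF n mult_right_mono[of "real n" "real k"]] that pos
    by (auto simp: bump_def)
  then show ?thesis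
    unfolding eventually_sequentially by blast
qed

section \<open>The outer measure of a functional\<close>

locale lipschitz_integral =
  fixes A :: "'a::metric_space set" and T :: "('a \<Rightarrow> real) \<Rightarrow> real"
  assumes closed: "closed A" and nonempty: "A \<noteq> {}"
    and pos: "positive_linear_functional A T"
    and soc: "seq_order_continuous (Lip A) T"
begin

section \<open>Linearity, monotonicity and monotone continuity of the functional\<close>

lemma T_add: "f \<in> Lip A \<Longrightarrow> g \<in> Lip A \<Longrightarrow> T (\<lambda>x. f x + g x) = T f + T g"
  using pos by (simp add: positive_linear_functional_def linear_functional_on_def)

lemma T_cmult: "f \<in> Lip A \<Longrightarrow> T (\<lambda>x. c * f x) = c * T f"
  using pos by (simp add: positive_linear_functional_def linear_functional_on_def)

lemma T_diff:
  assumes "f \<in> Lip A" "g \<in> Lip A"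
  shows "T (\<lambda>x. f x - g x) = T f - T g"
  using T_add[OF assms(1) Lip_cmult[OF assms(2)], of "- 1"] T_cmult[OF assms(2), of "- 1"] by simp

lemma T_zero: "T (\<lambda>x. 0) = 0"
  using T_diff[OF Lip_zero Lip_zero] by simp

lemma T_sum:
  assumes "\<And>i. i \<in> I \<Longrightarrow> f i \<in> Lip A"
  shows "T (\<lambda>x. \<Sum>i\<in>I. f i x) = (\<Sum>i\<in>I. T (f i))"
  using assms
  by (induction I rule: infinite_finite_induct) (auto simp: T_zero T_add Lip_sum)

lemma T_nonneg: "f \<in> Lip A \<Longrightarrow> (\<And>x. 0 \<le> f x) \<Longrightarrow> 0 \<le> T f"
  using pos by (simp add: positive_linear_functional_def Lip_plus_def)

lemma T_mono: "f \<in> Lip A \<Longrightarrow> g \<in> Lip A \<Longrightarrow> (\<And>x. f x \<le> g x) \<Longrightarrow> T f \<le> T g"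
  using T_nonneg[OF Lip_diff[of g A f]] T_diff[of g f] by simp

text \<open>Pointwise convergence to \<open>0\<close> implies infimum \<open>0\<close> in the Riesz
  space, because every lower bound lies pointwise below the limit. The sequence then serves as its
  own dominating sequence.\<close>

lemma T_tendsto_zero:
  assumes h: "\<And>k. h k \<in> Lip A" "\<And>k x. h (Suc k) x \<le> h k x" "\<And>x. (\<lambda>k. h k x) \<longlonglongrightarrow> 0"
  shows "(\<lambda>k. T (h k)) \<longlonglongrightarrow> 0"
proof -
  have dec: "decseq (\<lambda>k. h k x)" for x
    by (intro decseq_SucI h)
  have ge: "0 \<le> h k x" for k x
    by (rule decseq_ge[OF dec h(3)])
  have "isGlb (Lip A) (range h) (\<lambda>_. 0)"
    unfolding isGlb_def greatestP_def isLb_def setge_def setle_def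
    by (auto simp: ge Lip_zero le_fun_def intro!: LIMSEQ_le_const[OF h(3)])
  moreover have "decseq h"
    by (intro decseq_SucI le_funI h)
  ultimately have "order_tends_to_zero (Lip A) h"
    unfolding order_tends_to_zero_def using h(1) ge by (intro exI[of _ h]) auto
  then show ?thesis
    using soc h(1) unfolding seq_order_continuous_def by blast
qed

lemma T_tendsto:
  assumes f: "f \<in> Lip A"
    and h: "\<And>k. h k \<in> Lip A" "\<And>k x. h k x \<le> h (Suc k) x" "\<And>x. (\<lambda>k. h k x) \<longlonglongrightarrow> f x"
  shows "(\<lambda>k. T (h k)) \<longlonglongrightarrow> T f"
proof -
  have "(\<lambda>k. T (\<lambda>x. f x - h k x)) \<longlonglongrightarrow> 0"
    using h f by (intro T_tendsto_zero Lip_diff) (auto intro!: tendsto_eq_intros)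
  then have "(\<lambda>k. T f - T (h k)) \<longlonglongrightarrow> 0"
    by (simp add: T_diff f h)
  from tendsto_diff[OF tendsto_const[of "T f"] this] show ?thesis
    by simp
qed

section \<open>Masses of open sets and their countable subadditivity\<close>

definition below :: "'a set \<Rightarrow> ('a \<Rightarrow> real) set" where
  "below U = {f \<in> Lip_plus A. \<forall>x. f x \<le> indicator U x}"

definition open_mass :: "'a set \<Rightarrow> ennreal" where
  "open_mass U = (SUP f\<in>below U. ennreal (T f))"

text \<open>Functions in \<open>below U\<close> vanish on \<open>A\<close>, so \<open>open_mass U\<close> only sees \<open>U - A\<close>. The values of \<open>outer\<close>
  on subsets of \<open>A\<close> need not be \<open>0\<close>, but they are irrelevant for the relative measure.\<close>

definition outer :: "'a set \<Rightarrow> ennreal" where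
  "outer E = (INF U\<in>{U. open U \<and> E \<subseteq> U}. open_mass U)"

lemma below_Lip: "f \<in> below U \<Longrightarrow> f \<in> Lip A"
  by (simp add: below_def Lip_plus_def)

lemma belowD: "f \<in> below U \<Longrightarrow> 0 \<le> f x" "f \<in> below U \<Longrightarrow> f x \<le> indicator U x"
  by (simp_all add: below_def Lip_plus_def)

lemma belowI: "f \<in> Lip A \<Longrightarrow> (\<And>x. 0 \<le> f x) \<Longrightarrow> (\<And>x. f x \<le> indicator U x) \<Longrightarrow> f \<in> below U"
  by (simp add: below_def Lip_plus_def)

lemma bump_below: "bump A U k \<in> below U"
  by (simp add: below_def bump_Lip_plus bump_le_indicator)

lemma zero_below: "(\<lambda>x. 0) \<in> below U"
  by (rule belowI) (auto simp: Lip_zero)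

lemma below_le_open_mass: "f \<in> below U \<Longrightarrow> ennreal (T f) \<le> open_mass U"
  unfolding open_mass_def by (rule SUP_upper)

text \<open>Every competitor for \<open>U\<close> lies below \<open>g\<close>, so positivity bounds
  the supremum. Such a \<open>g\<close> exists only if \<open>U\<close> misses \<open>A\<close>; the
  real bound \<open>T g\<close> is the source of finite masses.\<close>

lemma open_mass_le: "g \<in> Lip A \<Longrightarrow> (\<And>x. indicator U x \<le> g x) \<Longrightarrow> open_mass U \<le> ennreal (T g)"
  unfolding open_mass_def
  by (rule SUP_least, rule ennreal_leI, rule T_mono)
    (auto intro: below_Lip order_trans[OF belowD(2)])

lemma open_mass_mono:
  assumes "U \<subseteq> V"
  shows "open_mass U \<le> open_mass V"
proof -
  have "indicator U x \<le> (indicator V x :: real)" for x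
    using assms by (auto simp: indicator_def)
  then have "below U \<subseteq> below V"
    unfolding below_def by (auto intro: order_trans)
  then show ?thesis
    unfolding open_mass_def by (intro SUP_subset_mono) auto
qed

text \<open>A competitor for the union is the increasing limit of its minima with finite sums of
  bumps, each bump being a competitor for one \<open>U n\<close>. Monotone continuity of
  \<open>T\<close> takes the place of a compactness argument.\<close>

lemma open_mass_UN:
  fixes U :: "nat \<Rightarrow> 'a set"
  assumes U: "\<And>n. open (U n)"
  shows "open_mass (\<Union>n. U n) \<le> (\<Sum>n. open_mass (U n))"
  unfolding open_mass_def[of "\<Union>n. U n"]
proof (rule SUP_least)
  fix f assume f: "f \<in> below (\<Union>n. U n)"
  \<comment> \<open>The index \<open>k\<close> counts the sets and sets the steepness of the bumps
    at once, so a single increasing sequence suffices.\<close>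
  define s where "s k x = (\<Sum>n<k. bump A (U n) k x)" for k x
  define h where "h k x = min (f x) (s k x)" for k x
  have bLip: "bump A V k \<in> Lip A" for V k
    using bump_below below_Lip by blast
  have b0: "0 \<le> bump A V k x" for V k x
    using bump_below belowD by blast
  have s: "s k \<in> Lip A" for k
    unfolding s_def by (intro Lip_sum bLip)
  have h: "h k \<in> Lip A" for k
    unfolding h_def by (intro Lip_min s below_Lip[OF f])
  have "s k x \<le> s (Suc k) x" for k x
    unfolding s_def by (simp add: b0 add_increasing2 bump_mono sum_mono)
  then have hmono: "h k x \<le> h (Suc k) x" for k x
    unfolding h_def by (intro min.mono) auto
  have lim: "(\<lambda>k. h k x) \<longlonglongrightarrow> f x" for x
  proof (cases "f x = 0")
    case True
    then have "h k x = 0" for k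
      unfolding h_def s_def by (simp add: b0 sum_nonneg)
    then show ?thesis using True by simp
  next
    case False
    then have fx: "0 < f x" "x \<notin> A"
      using belowD(1)[OF f, of x] below_Lip[OF f] by (auto simp: Lip_def)
    then have "x \<in> (\<Union>n. U n)"
      using belowD(2)[OF f, of x] by (cases "x \<in> (\<Union>n. U n)") auto
    then obtain n where n: "x \<in> U n"
      by blast
    have f1: "f x \<le> 1"
      using belowD(2)[OF f, of x] by (rule order_trans) (rule indicator_le_1)
    \<comment> \<open>As soon as one bump of the sum has reached \<open>1\<close>, the sum is at
      least \<open>1\<close>, hence at least \<open>f x\<close>, and the minimum equals
      \<open>f x\<close>.\<close>
    have "\<forall>\<^sub>F k in sequentially. h k x = f x"
      using bump_eventually_1[OF closed nonempty U n fx(2)] eventually_gt_at_top[of n]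
    proof eventually_elim
      case (elim k)
      have "bump A (U n) k x \<le> s k x"
        unfolding s_def using elim by (intro member_le_sum b0) auto
      then show ?case
        using elim f1 by (simp add: h_def)
    qed
    then show ?thesis by (rule tendsto_eventually)
  qed
  have bound: "ennreal (T (h k)) \<le> (\<Sum>n. open_mass (U n))" for k
  proof -
    have "T (h k) \<le> (\<Sum>n<k. T (bump A (U n) k))"
      unfolding T_sum[OF bLip, symmetric] s_def[symmetric]
      by (intro T_mono h s) (simp add: h_def)
    then have "ennreal (T (h k)) \<le> (\<Sum>n<k. ennreal (T (bump A (U n) k)))"
      using T_nonneg[OF bLip b0] by (subst sum_ennreal) (auto intro: ennreal_leI)
    also have "\<dots> \<le> (\<Sum>n<k. open_mass (U n))"
      by (intro sum_mono below_le_open_mass bump_below)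
    also have "\<dots> \<le> (\<Sum>n. open_mass (U n))"
      by (intro sum_le_suminf) auto
    finally show ?thesis .
  qed
  show "ennreal (T f) \<le> (\<Sum>n. open_mass (U n))"
    using bound tendsto_ennrealI[OF T_tendsto[OF below_Lip[OF f] h hmono lim]]
    by (intro LIMSEQ_le_const2) auto
qed

section \<open>The outer measure\<close>

lemma outer_open: "open U \<Longrightarrow> outer U = open_mass U"
  unfolding outer_def by (intro antisym INF_lower INF_greatest open_mass_mono) auto

lemma outer_mono: "E \<subseteq> F \<Longrightarrow> outer E \<le> outer F"
  unfolding outer_def by (intro INF_superset_mono) auto

lemma outer_empty: "outer {} = 0"
proof -
  have "open_mass {} \<le> ennreal (T (\<lambda>x. 0))"
    by (rule open_mass_le) (auto simp: Lip_zero)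
  then show ?thesis
    by (simp add: outer_open T_zero)
qed

lemma outer_approx:
  assumes "outer E < c"
  obtains U where "open U" "E \<subseteq> U" "open_mass U < c"
  using assms unfolding outer_def INF_less_iff by auto

lemma outer_UN:
  fixes E :: "nat \<Rightarrow> 'a set"
  shows "outer (\<Union>n. E n) \<le> (\<Sum>n. outer (E n))"
proof (rule ennreal_le_epsilon)
  fix e :: real assume e: "0 < e" and fin: "(\<Sum>n. outer (E n)) < top"
  \<comment> \<open>A finite sum has finite terms, and only then is adding a positive amount a
    strict increase.\<close>
  have "outer (E n) < outer (E n) + e * (1/2)^Suc n" for n
    using ennreal_suminf_lessD[OF fin] e by (auto simp: less_top)
  then have "\<exists>U. open U \<and> E n \<subseteq> U \<and> open_mass U < outer (E n) + e * (1/2)^Suc n" for n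
    by (metis outer_approx)
  then obtain U where U: "\<And>n. open (U n)" "\<And>n. E n \<subseteq> U n"
      "\<And>n. open_mass (U n) < outer (E n) + e * (1/2)^Suc n"
    by metis
  have "outer (\<Union>n. E n) \<le> outer (\<Union>n. U n)"
    using U(2) by (intro outer_mono) auto
  also have "\<dots> \<le> (\<Sum>n. open_mass (U n))"
    using U(1) by (subst outer_open) (auto intro: open_mass_UN)
  also have "\<dots> \<le> (\<Sum>n. outer (E n) + e * (1/2) ^ Suc n)"
    by (intro suminf_le less_imp_le U) auto
  also have "\<dots> = (\<Sum>n. outer (E n)) + (\<Sum>n. ennreal e * ennreal ((1/2) ^ Suc n))"
    using e by (subst suminf_add[symmetric])
      (auto simp del: ennreal_suminf_cmult simp add: ennreal_mult[symmetric])
  also have "\<dots> = (\<Sum>n. outer (E n)) + e"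
    unfolding ennreal_suminf_cmult
    by (subst suminf_ennreal_eq[OF zero_le_power power_half_series]) auto
  finally show "outer (\<Union>n. E n) \<le> (\<Sum>n. outer (E n)) + e" .
qed

lemma outer_measure_space_outer: "outer_measure_space UNIV outer"
  unfolding outer_measure_space_def positive_def increasing_def countably_subadditive_def
  using outer_empty outer_mono outer_UN by auto

lemma outer_Un: "outer (E \<union> F) \<le> outer E + outer F"
proof -
  have "outer (E \<union> F) = outer (\<Union>n. binaryset E F n)"
    by (simp add: UN_binaryset_eq)
  also have "\<dots> \<le> (\<Sum>n. outer (binaryset E F n))"
    by (rule outer_UN)
  also have "\<dots> = outer E + outer F"
    by (rule suminf_binaryset_eq) (rule outer_empty)
  finally show ?thesis .
qed

text \<open>Cutting \<open>f\<close> off below \<open>\<epsilon>\<close> leaves room for functions supported in the open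
  set \<open>{x \<in> U. f x < \<epsilon>} \<supseteq> U - V\<close>.\<close>

lemma outer_split_open:
  assumes U: "open U" and V: "open V"
  shows "outer (U \<inter> V) + outer (U - V) \<le> open_mass U"
proof -
  have key: "ennreal (T f) + outer (U - V) \<le> open_mass U" if f: "f \<in> below (U \<inter> V)" for f
  proof -
    \<comment> \<open>The remainder \<open>f - c n\<close> vanishes where \<open>f\<close> is below
      the cutoff, and it increases to \<open>f\<close> as the cutoff tends to
      \<open>0\<close>.\<close>
    define c where "c n x = min (f x) (inverse (real (Suc n)))" for n x
    have c: "c n \<in> Lip A" for n
      unfolding c_def by (intro Lip_min_const below_Lip[OF f]) auto
    have fc: "(\<lambda>x. f x - c n x) \<in> Lip A" for n
      by (intro Lip_diff below_Lip[OF f] c)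
    have "(\<lambda>n. T (\<lambda>x. f x - c n x)) \<longlonglongrightarrow> T f"
    proof (rule T_tendsto[OF below_Lip[OF f] fc])
      show "f x - c k x \<le> f x - c (Suc k) x" for k x
        unfolding c_def by (intro diff_left_mono min.mono le_imp_inverse_le) auto
      show "(\<lambda>k. f x - c k x) \<longlonglongrightarrow> f x" for x
      proof -
        have "(\<lambda>k. f x - c k x) \<longlonglongrightarrow> f x - min (f x) 0"
          unfolding c_def by (intro tendsto_intros LIMSEQ_inverse_real_of_nat)
        then show ?thesis using belowD(1)[OF f, of x] by simp
      qed
    qed
    then have lim: "(\<lambda>n. ennreal (T (\<lambda>x. f x - c n x)) + outer (U - V)) \<longlonglongrightarrow> ennreal (T f) + outer (U - V)"
      by (intro tendsto_add tendsto_const tendsto_ennrealI)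
    have "ennreal (T (\<lambda>x. f x - c n x)) + outer (U - V) \<le> open_mass U" for n
    proof -
      define W where "W = U \<inter> {x. f x < inverse (real (Suc n))}"
      have W: "open W" "U - V \<subseteq> W"
      proof -
        show "open W"
          unfolding W_def using U Lip_open_gt(2)[OF below_Lip[OF f]] by (rule open_Int)
        have "f x < inverse (real (Suc n))" if "x \<notin> V" for x
          using belowD(2)[OF f, of x] that by (intro le_less_trans[of "f x" 0]) simp_all
        then show "U - V \<subseteq> W"
          unfolding W_def by blast
      qed
      have "ennreal (T (\<lambda>x. f x - c n x)) + ennreal (T g) \<le> open_mass U" if g: "g \<in> below W" for g
      proof -
        have "ennreal (T (\<lambda>x. f x - c n x)) + ennreal (T g) = ennreal (T (\<lambda>x. (f x - c n x) + g x))"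
          using T_nonneg[OF fc, of n] T_nonneg[OF below_Lip[OF g] belowD(1)[OF g]]
          unfolding T_add[OF fc below_Lip[OF g]] by (simp add: c_def)
        also have "\<dots> \<le> open_mass U"
        proof (rule below_le_open_mass, rule belowI)
          show "(\<lambda>x. f x - c n x + g x) \<in> Lip A"
            by (intro Lip_add fc below_Lip[OF g])
          show "0 \<le> f x - c n x + g x" for x
            using belowD(1)[OF g, of x] by (simp add: c_def)
          \<comment> \<open>Below the cutoff only \<open>g x\<close> remains. At or above it
            \<open>x\<close> lies outside \<open>W\<close>, so \<open>g x = 0\<close> and
            \<open>f x\<close> alone respects the bound.\<close>
          show "f x - c n x + g x \<le> indicator U x" for x
            using belowD[OF g, of x] belowD[OF f, of x]
            by (cases "x \<in> U"; cases "x \<in> V"; cases "f x < inverse (real (Suc n))")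
              (simp_all add: c_def W_def diff_le_eq add_increasing2)
        qed
        finally show ?thesis .
      qed
      \<comment> \<open>Moving the supremum out of the sum requires a nonempty family; the zero
        function provides a member.\<close>
      then have "ennreal (T (\<lambda>x. f x - c n x)) + open_mass W \<le> open_mass U"
        unfolding open_mass_def[of W] using zero_below[of W]
        by (subst ennreal_SUP_add_right) (auto intro!: SUP_least)
      moreover have "outer (U - V) \<le> open_mass W"
        using outer_mono[OF W(2)] outer_open[OF W(1)] by simp
      ultimately show ?thesis
        by (meson add_left_mono order_trans)
    qed
    then show ?thesis
      using lim by (intro LIMSEQ_le_const2) auto
  qed
  have "outer (U \<inter> V) = open_mass (U \<inter> V)"
    using U V by (intro outer_open) auto
  also have "\<dots> + outer (U - V) \<le> open_mass U"
    unfolding open_mass_def[of "U \<inter> V"] using key zero_below[of "U \<inter> V"]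
    by (subst ennreal_SUP_add_left[symmetric]) (auto intro!: SUP_least)
  finally show ?thesis .
qed

text \<open>An arbitrary test set \<open>E\<close> is replaced by an open superset \<open>U\<close>,
  for which \<open>outer_split_open\<close> applies; the infimum over \<open>U\<close> then gives
  the bound for \<open>E\<close>.\<close>

lemma open_lambda_system:
  assumes V: "open V"
  shows "V \<in> lambda_system UNIV UNIV outer"
proof -
  have "outer (V \<inter> E) + outer (- V \<inter> E) = outer E" for E
  proof (rule antisym)
    show "outer E \<le> outer (V \<inter> E) + outer (- V \<inter> E)"
      using outer_Un[of "V \<inter> E" "- V \<inter> E"] by (simp add: Int_Un_distrib2[symmetric])
    have "outer (V \<inter> E) + outer (- V \<inter> E) \<le> open_mass U" if "open U" "E \<subseteq> U" for U
    proof -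
      have "outer (V \<inter> E) \<le> outer (U \<inter> V)" "outer (- V \<inter> E) \<le> outer (U - V)"
        using that(2) by (auto intro: outer_mono)
      from order_trans[OF add_mono[OF this] outer_split_open[OF that(1) V]] show ?thesis .
    qed
    then show "outer (V \<inter> E) + outer (- V \<inter> E) \<le> outer E"
      unfolding outer_def[of E] by (intro INF_greatest) auto
  qed
  then show ?thesis
    by (simp add: lambda_system_def Compl_eq_Diff_UNIV)
qed

section \<open>The Borel measure of the functional\<close>

definition mu :: "'a measure" where
  "mu = measure_of UNIV (sets borel) outer"

lemma sets_mu: "sets mu = sets borel"
  by (simp add: mu_def sets.sigma_sets_eq[of borel, simplified])

text \<open>\<open>measure_of\<close> retains the values of \<open>outer\<close> only where these
  form a measure. The Caratheodory measurable sets form a sigma-algebra on which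
  \<open>outer\<close> is countably additive, and since it contains the open sets it contains all
  Borel sets.\<close>

lemma emeasure_mu:
  assumes "E \<in> sets borel"
  shows "emeasure mu E = outer E"
proof -
  interpret U: sigma_algebra "UNIV :: 'a set" UNIV
    using sigma_algebra_Pow[of "UNIV :: 'a set"] by simp
  have ms: "measure_space UNIV (lambda_system UNIV UNIV outer) outer"
    by (rule U.caratheodory_lemma) (rule outer_measure_space_outer)
  then have sa: "sigma_algebra UNIV (lambda_system UNIV UNIV outer)"
    by (simp add: measure_space_def)
  have "sigma_sets UNIV {S. open S} \<subseteq> lambda_system UNIV UNIV outer"
    using open_lambda_system by (intro sigma_algebra.sigma_sets_subset[OF sa]) blast
  then have sub: "sets borel \<subseteq> lambda_system UNIV UNIV outer"
    by (simp add: sets_borel)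
  have ca: "countably_additive (lambda_system UNIV UNIV outer) outer"
    using ms unfolding measure_space_def by (elim conjE)
  have ca': "countably_additive (sets borel) outer"
  proof (rule countably_additiveI)
    fix F :: "nat \<Rightarrow> 'a set"
    assume F: "range F \<subseteq> sets borel" "disjoint_family F" "(\<Union>i. F i) \<in> sets borel"
    show "(\<Sum>i. outer (F i)) = outer (\<Union>i. F i)"
      by (rule ca[unfolded countably_additive_def, rule_format, OF subset_trans[OF F(1) sub] F(2) subsetD[OF sub F(3)]])
  qed
  have pos': "positive (sets borel) outer"
    by (simp add: positive_def outer_empty)
  have sa': "sigma_algebra UNIV (sets (borel :: 'a measure))"
    using sets.sigma_algebra_axioms[of "borel :: 'a measure"] by simp
  show ?thesis
    unfolding mu_def by (rule emeasure_measure_of_sigma[OF sa' pos' ca' assms])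
qed

lemma emeasure_mu_open: "open U \<Longrightarrow> emeasure mu U = open_mass U"
  by (simp add: emeasure_mu outer_open)

section \<open>Representation by the integral\<close>

text \<open>Division by the height \<open>d\<close> turns \<open>g\<close> into a competitor for
  \<open>U\<close>. Together with the opposite estimate \<open>open_mass_le_T\<close> this carries
  pointwise bounds by indicators over to the functional.\<close>

lemma T_le_open_mass:
  assumes g: "g \<in> Lip A" "\<And>x. 0 \<le> g x" "\<And>x. g x \<le> d * indicator U x" and d: "0 < d"
  shows "ennreal (T g) \<le> ennreal d * open_mass U"
proof -
  have "(\<lambda>x. (1 / d) * g x) \<in> below U"
    using g d by (intro belowI Lip_cmult) (auto simp: field_simps)
  then have "ennreal ((1 / d) * T g) \<le> open_mass U"
    using below_le_open_mass T_cmult[OF g(1), of "1 / d"] by metis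
  then have "ennreal d * ennreal ((1 / d) * T g) \<le> ennreal d * open_mass U"
    by (rule mult_left_mono) simp
  then show ?thesis
    using d T_nonneg[OF g(1,2)] by (simp add: ennreal_mult[symmetric])
qed

lemma open_mass_le_T:
  assumes g: "g \<in> Lip A" "\<And>x. d * indicator U x \<le> g x" and d: "0 < d"
  shows "ennreal d * open_mass U \<le> ennreal (T g)"
proof -
  have g0: "0 \<le> g x" for x
    using d by (intro order_trans[OF _ g(2)]) auto
  have "open_mass U \<le> ennreal (T (\<lambda>x. (1 / d) * g x))"
  proof (rule open_mass_le[OF Lip_cmult[OF g(1)]])
    show "indicator U x \<le> (1 / d) * g x" for x
      using g(2)[of x] d by (simp add: pos_le_divide_eq mult.commute)
  qed
  then have "open_mass U \<le> ennreal ((1 / d) * T g)"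
    by (simp only: T_cmult[OF g(1)])
  then have "ennreal d * open_mass U \<le> ennreal d * ennreal ((1 / d) * T g)"
    by (rule mult_left_mono) simp
  then show ?thesis
    using d T_nonneg[OF g(1) g0] by (simp add: ennreal_mult[symmetric])
qed

section \<open>Horizontal layers and staircase functions\<close>

definition layer :: "('a \<Rightarrow> real) \<Rightarrow> real \<Rightarrow> nat \<Rightarrow> 'a \<Rightarrow> real" where
  "layer f d j x = min (f x) ((real j + 1) * d) - min (f x) (real j * d)"

text \<open>The sum starts at \<open>j = 1\<close> because \<open>{x. 0 < f x}\<close> may have
  infinite mass, whereas the higher superlevel sets of a nonnegative \<open>f\<close> in
  \<open>Lip A\<close> have finite mass.\<close>

definition staircase :: "('a \<Rightarrow> real) \<Rightarrow> real \<Rightarrow> nat \<Rightarrow> 'a \<Rightarrow> ennreal" where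
  "staircase f d N x = (\<Sum>j=1..N. ennreal d * indicator {x. real j * d < f x} x)"

lemma layer_bounds:
  assumes "0 < d"
  shows "0 \<le> layer f d j x" "layer f d j x \<le> d * indicator {x. real j * d < f x} x"
    "d * indicator {x. real (Suc j) * d < f x} x \<le> layer f d j x"
  using assms by (auto simp: layer_def algebra_simps min_def indicator_def)

lemma layer_Lip: "f \<in> Lip A \<Longrightarrow> 0 < d \<Longrightarrow> layer f d j \<in> Lip A"
  unfolding layer_def by (intro Lip_diff Lip_min_const) auto

text \<open>Both sums telescope. The second one lacks the bottom layer, whence the subtracted
  \<open>min (f x) d\<close>.\<close>

lemma sum_layer:
  "(\<Sum>j<N. layer f d j x) = min (f x) (real N * d) - min (f x) 0"
  "(\<Sum>j=1..N. layer f d j x) = min (f x) ((real N + 1) * d) - min (f x) d"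
  by (induction N) (simp_all add: layer_def add.commute)

lemma nn_integral_staircase:
  assumes "f \<in> Lip A"
  shows "(\<integral>\<^sup>+x. staircase f d N x \<partial>mu) = (\<Sum>j=1..N. ennreal d * open_mass {x. real j * d < f x})"
proof -
  have o: "open {x. real j * d < f x}" for j
    using assms by (rule Lip_open_gt)
  then have b: "{x. real j * d < f x} \<in> sets mu" for j
    by (simp add: sets_mu)
  have "(\<integral>\<^sup>+x. staircase f d N x \<partial>mu) = (\<Sum>j=1..N. \<integral>\<^sup>+x. ennreal d * indicator {x. real j * d < f x} x \<partial>mu)"
    unfolding staircase_def using b
    by (intro nn_integral_sum borel_measurable_times_ennreal borel_measurable_const borel_measurable_indicator)
  also have "\<dots> = (\<Sum>j=1..N. ennreal d * open_mass {x. real j * d < f x})"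
    using b by (simp add: nn_integral_cmult_indicator emeasure_mu_open[OF o])
  finally show ?thesis .
qed

lemma staircase_bounds:
  assumes "0 < d" "0 \<le> f x"
  shows "ennreal (min (f x) ((real N + 1) * d) - min (f x) d) \<le> staircase f d N x"
    "staircase f d N x \<le> ennreal (f x)"
proof -
  have s: "staircase f d N x = ennreal (\<Sum>j=1..N. d * indicator {x. real j * d < f x} x)"
    unfolding staircase_def using assms(1)
    by (subst sum_ennreal[symmetric]) (auto simp: ennreal_mult' ennreal_indicator)
  show "ennreal (min (f x) ((real N + 1) * d) - min (f x) d) \<le> staircase f d N x"
    unfolding s sum_layer(2)[symmetric] by (intro ennreal_leI sum_mono layer_bounds assms)
  \<comment> \<open>The shift pairs step \<open>Suc j\<close> with layer \<open>j\<close>: above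
    height \<open>Suc j * d\<close> that layer is already full.\<close>
  have "(\<Sum>j=1..N. d * indicator {x. real j * d < f x} x) = (\<Sum>j<N. d * indicator {x. real (Suc j) * d < f x} x)"
    by (simp only: One_nat_def sum.atLeast_Suc_atMost_Suc_shift sum.atLeast1_atMost_eq)
  also have "\<dots> \<le> (\<Sum>j<N. layer f d j x)"
    by (intro sum_mono layer_bounds assms)
  also have "\<dots> \<le> f x"
    using assms by (simp add: sum_layer)
  finally show "staircase f d N x \<le> ennreal (f x)"
    unfolding s by (rule ennreal_leI)
qed

text \<open>The proof of \<open>staircase_bounds\<close> is repeated with \<open>T\<close> of a
  layer in place of its value and the mass of a superlevel set in place of its indicator. The same
  staircase thus controls both \<open>T f\<close> and the integral of \<open>f\<close>.\<close>

lemma staircase_T_bounds: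
  assumes f: "f \<in> Lip A" "\<And>x. 0 \<le> f x" and d: "0 < d"
  shows "ennreal (T (\<lambda>x. min (f x) ((real N + 1) * d) - min (f x) d)) \<le> (\<integral>\<^sup>+x. staircase f d N x \<partial>mu)"
    "(\<integral>\<^sup>+x. staircase f d N x \<partial>mu) \<le> ennreal (T f)"
proof -
  note l = layer_Lip[OF f(1) d]
  have lT: "0 \<le> T (layer f d j)" for j
    by (intro T_nonneg l layer_bounds d)
  have "ennreal (T (\<lambda>x. min (f x) ((real N + 1) * d) - min (f x) d)) = (\<Sum>j=1..N. ennreal (T (layer f d j)))"
    unfolding sum_layer(2)[symmetric] T_sum[OF l] by (simp add: sum_ennreal lT)
  also have "\<dots> \<le> (\<Sum>j=1..N. ennreal d * open_mass {x. real j * d < f x})"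
    by (intro sum_mono T_le_open_mass l layer_bounds d)
  finally show "ennreal (T (\<lambda>x. min (f x) ((real N + 1) * d) - min (f x) d)) \<le> (\<integral>\<^sup>+x. staircase f d N x \<partial>mu)"
    by (simp only: nn_integral_staircase[OF f(1)])
  have "(\<integral>\<^sup>+x. staircase f d N x \<partial>mu) = (\<Sum>j<N. ennreal d * open_mass {x. real (Suc j) * d < f x})"
    by (simp only: nn_integral_staircase[OF f(1)] One_nat_def sum.atLeast1_atMost_eq)
  also have "\<dots> \<le> (\<Sum>j<N. ennreal (T (layer f d j)))"
    by (intro sum_mono open_mass_le_T l layer_bounds d)
  also have "\<dots> = ennreal (T (\<lambda>x. \<Sum>j<N. layer f d j x))"
    unfolding T_sum[OF l] by (simp add: sum_ennreal lT)
  also have "\<dots> \<le> ennreal (T f)"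
    using f(2) by (intro ennreal_leI T_mono f(1) Lip_sum l) (simp add: sum_layer)
  finally show "(\<integral>\<^sup>+x. staircase f d N x \<partial>mu) \<le> ennreal (T f)" .
qed

text \<open>With \<open>l n\<close> increasing to \<open>f\<close>, the integral of the staircase
  \<open>s n\<close> lies above both \<open>T (l n)\<close> and the integral of \<open>l n\<close>,
  and below both \<open>T f\<close> and the integral of \<open>f\<close>. Monotone continuity of
  \<open>T\<close> gives one inequality in the limit, monotone convergence the other.\<close>

lemma nn_integral_mu:
  assumes f: "f \<in> Lip A" "\<And>x. 0 \<le> f x"
  shows "(\<integral>\<^sup>+x. ennreal (f x) \<partial>mu) = ennreal (T f)"
proof -
  define l where "l n x = min (f x) (real (Suc n)) - min (f x) (inverse (real (Suc n)))" for n x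
  have lLip: "l n \<in> Lip A" for n
    unfolding l_def by (intro Lip_diff Lip_min_const f) auto
  have lmono: "l n x \<le> l (Suc n) x" for n x
    unfolding l_def by (intro diff_mono min.mono le_imp_inverse_le) auto
  have llim: "(\<lambda>n. l n x) \<longlonglongrightarrow> f x" for x
  proof -
    have "\<forall>\<^sub>F n in sequentially. min (f x) (real (Suc n)) = f x"
      using eventually_ge_at_top[of "nat \<lceil>f x\<rceil>"] by eventually_elim linarith
    then have "(\<lambda>n. min (f x) (real (Suc n))) \<longlonglongrightarrow> f x"
      by (rule tendsto_eventually)
    then have "(\<lambda>n. l n x) \<longlonglongrightarrow> f x - min (f x) 0"
      unfolding l_def by (intro tendsto_diff tendsto_min tendsto_const LIMSEQ_inverse_real_of_nat)
    then show ?thesis using f(2)[of x] by simp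
  qed
  \<comment> \<open>Mesh \<open>1 / (n + 1)\<close> with \<open>(n + 1)^2\<close> steps reaches
    height \<open>n + 1\<close>, so the staircase dominates the truncation
    \<open>l n\<close>.\<close>
  define s where "s n = staircase f (inverse (real (Suc n))) (Suc n * Suc n)" for n
  have d: "0 < inverse (real (Suc n))" for n
    by simp
  have top: "real (Suc n) \<le> (real (Suc n * Suc n) + 1) * inverse (real (Suc n))" for n
    by (simp add: field_simps)
  have ls: "l n x \<le> min (f x) ((real (Suc n * Suc n) + 1) * inverse (real (Suc n))) - min (f x) (inverse (real (Suc n)))" for n x
    unfolding l_def by (intro diff_mono min.mono top order_refl)
  have sT: "ennreal (T (l n)) \<le> (\<integral>\<^sup>+x. s n x \<partial>mu)" for n
    unfolding s_def
    by (rule order_trans[OF ennreal_leI[OF T_mono[OF lLip _ ls]] staircase_T_bounds(1)[OF f d]])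
      (intro Lip_diff Lip_min_const f; simp)
  have meas: "l n \<in> borel_measurable mu" for n
    using Lip_borel_measurable[OF lLip] by (simp add: measurable_cong_sets[OF sets_mu refl])
  have upper: "ennreal (T f) \<le> (\<integral>\<^sup>+x. ennreal (f x) \<partial>mu)"
  proof (rule LIMSEQ_le_const2)
    show "(\<lambda>n. ennreal (T (l n))) \<longlonglongrightarrow> ennreal (T f)"
      by (intro tendsto_ennrealI T_tendsto f lLip lmono llim)
    have "(\<integral>\<^sup>+x. s n x \<partial>mu) \<le> (\<integral>\<^sup>+x. ennreal (f x) \<partial>mu)" for n
      unfolding s_def by (intro nn_integral_mono staircase_bounds f d)
    then show "\<exists>N. \<forall>n\<ge>N. ennreal (T (l n)) \<le> (\<integral>\<^sup>+x. ennreal (f x) \<partial>mu)"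
      using sT order_trans by blast
  qed
  have "(\<lambda>n. \<integral>\<^sup>+x. ennreal (l n x) \<partial>mu) \<longlonglongrightarrow> (\<integral>\<^sup>+x. ennreal (f x) \<partial>mu)"
    using meas llim
    by (intro nn_integral_LIMSEQ tendsto_ennrealI)
      (auto simp: incseq_Suc_iff le_fun_def intro!: ennreal_leI lmono)
  moreover have "(\<integral>\<^sup>+x. ennreal (l n x) \<partial>mu) \<le> ennreal (T f)" for n
  proof -
    have "(\<integral>\<^sup>+x. ennreal (l n x) \<partial>mu) \<le> (\<integral>\<^sup>+x. s n x \<partial>mu)"
      unfolding s_def
      by (intro nn_integral_mono order_trans[OF ennreal_leI[OF ls] staircase_bounds(1)] d f)
    also have "\<dots> \<le> ennreal (T f)"
      unfolding s_def by (intro staircase_T_bounds f d)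
    finally show ?thesis .
  qed
  ultimately have "(\<integral>\<^sup>+x. ennreal (f x) \<partial>mu) \<le> ennreal (T f)"
    by (intro LIMSEQ_le_const2) auto
  then show ?thesis
    using upper by (rule antisym)
qed

lemma integral_mu:
  assumes f: "f \<in> Lip A"
  shows "(\<integral>x. f x \<partial>mu) = T f"
proof -
  \<comment> \<open>The nonnegative integral is the finite number \<open>T g\<close>, which gives
    integrability, so the Bochner integral is not the default \<open>0\<close>.\<close>
  have *: "integrable mu g \<and> (\<integral>x. g x \<partial>mu) = T g" if g: "g \<in> Lip A" "\<And>x. 0 \<le> g x" for g
    using nn_integral_mu[OF g] T_nonneg[OF g] g(2) Lip_borel_measurable[OF g(1)]
    by (subst (asm) nn_integral_eq_integrable) (auto simp: measurable_cong_sets[OF sets_mu refl])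
  \<comment> \<open>\<open>p\<close> is the positive part of \<open>f\<close>, and
    \<open>p - f\<close> is the negative part.\<close>
  define p where "p x = f x - min (f x) 0" for x
  have p: "p \<in> Lip A" "\<And>x. 0 \<le> p x"
    unfolding p_def by (intro Lip_diff Lip_min_const f order_refl) simp
  have q: "(\<lambda>x. p x - f x) \<in> Lip A" "\<And>x. 0 \<le> p x - f x"
    by (rule Lip_diff[OF p(1) f]) (simp add: p_def)
  have "(\<integral>x. f x \<partial>mu) = (\<integral>x. p x - (p x - f x) \<partial>mu)"
    by simp
  also have "\<dots> = T p - T (\<lambda>x. p x - f x)"
    using *[OF p] *[OF q] by (subst Bochner_Integration.integral_diff) auto
  also have "\<dots> = T f"
    by (simp add: T_diff p f)
  finally show ?thesis .
qed

text \<open>Markov's inequality for \<open>T\<close>: the function \<open>infdist x A / c\<close>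
  dominates the indicator of the set.\<close>

lemma finite_mu_away_from_A:
  assumes c: "0 < c"
  shows "emeasure mu {x. c < infdist x A} < \<infinity>"
proof -
  have d: "(\<lambda>x. infdist x A) \<in> Lip A"
    by (rule Lip_infdist) simp
  have "emeasure mu {x. c < infdist x A} = open_mass {x. c < infdist x A}"
    by (rule emeasure_mu_open[OF Lip_open_gt(1)[OF d]])
  also have "\<dots> \<le> ennreal (T (\<lambda>x. (1 / c) * infdist x A))"
    using c by (intro open_mass_le Lip_cmult d) (auto simp: indicator_def field_simps infdist_nonneg)
  finally show ?thesis
    by (rule order.strict_trans1) simp
qed

end

section \<open>Tightness\<close>

locale exhausted_lipschitz_integral = lipschitz_integral +
  assumes exh: "exhausted_by_compacts A T"
begin

text \<open>Competitors for \<open>{x. c < infdist x A} - K\<close> vanish on \<open>K\<close> and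
  lie below \<open>infdist x A / c\<close>. Exhaustion for this one function therefore bounds the
  mass of the whole set.\<close>

lemma compact_exhaustion:
  assumes c: "0 < c" and e: "0 < e"
  obtains K where "compact K" "K \<subseteq> - A" "emeasure mu ({x. c < infdist x A} - K) \<le> ennreal e"
proof -
  define f where "f x = (1 / c) * infdist x A" for x
  have d: "(\<lambda>x. infdist x A) \<in> Lip A"
    by (rule Lip_infdist) simp
  then have f: "f \<in> Lip A" "f \<in> Lip_plus A"
    using c Lip_cmult[OF d, of "1 / c"] unfolding Lip_plus_def f_def
    by (simp_all add: infdist_nonneg)
  obtain K where K: "compact K" "K \<subseteq> - A"
      "Sup {T g | g. g \<in> Lip_plus A \<and> (\<forall>x\<in>K. g x = 0) \<and> g \<le> f} < e"
    using exh f(2) e unfolding exhausted_by_compacts_def by blast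
  \<comment> \<open>A real \<open>Sup\<close> is known to dominate its members only for a set
    bounded above; here \<open>T f\<close> is a bound.\<close>
  have bdd: "bdd_above {T g | g. g \<in> Lip_plus A \<and> (\<forall>x\<in>K. g x = 0) \<and> g \<le> f}"
    unfolding bdd_above_def using f(1)
    by (intro exI[of _ "T f"]) (auto intro!: T_mono simp: Lip_plus_def le_fun_def)
  define V where "V = {x. c < infdist x A} - K"
  have "open V"
    unfolding V_def by (intro open_Diff Lip_open_gt(1)[OF d] compact_imp_closed K)
  have "ennreal (T g) \<le> ennreal e" if g: "g \<in> below V" for g
  proof (rule ennreal_leI)
    have gK: "g x = 0" if "x \<in> K" for x
      using belowD[OF g, of x] that by (auto simp: V_def)
    have "indicator V x \<le> f x" for x
      using c by (auto simp: V_def f_def indicator_def field_simps infdist_nonneg)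
    then have "g \<le> f"
      using belowD(2)[OF g] by (auto simp: le_fun_def intro: order_trans)
    then have "T g \<le> Sup {T g | g. g \<in> Lip_plus A \<and> (\<forall>x\<in>K. g x = 0) \<and> g \<le> f}"
      using g gK by (intro cSup_upper bdd) (auto simp: below_def)
    then show "T g \<le> e"
      using K(3) by simp
  qed
  then have "emeasure mu V \<le> ennreal e"
    unfolding emeasure_mu_open[OF \<open>open V\<close>] open_mass_def by (rule SUP_least)
  then show ?thesis
    using K that unfolding V_def by blast
qed

text \<open>An open \<open>U\<close> that barely exceeds \<open>X - E\<close> leaves the closed set
  \<open>X - U\<close> inside \<open>E\<close>. Intersecting it with a compact set from the
  exhaustion makes it compact; each of the two operations costs \<open>e / 2\<close>.\<close>

lemma compact_approx:
  assumes E: "E \<in> sets borel" "E \<subseteq> {x. c \<le> infdist x A}" and c: "0 < c" and e: "0 < e"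
  obtains K where "compact K" "K \<subseteq> E" "emeasure mu E \<le> emeasure mu K + ennreal e"
proof -
  define X where "X = {x. c \<le> infdist x A}"
  \<comment> \<open>Halving the level gives an open set of finite mass around the closed set
    \<open>X\<close>.\<close>
  define W where "W = {x. c / 2 < infdist x A}"
  have "closed X"
    unfolding X_def by (intro closed_Collect_le continuous_intros)
  then have XE: "X - E \<in> sets mu"
    using E(1) by (simp add: sets_mu borel_closed sets.Diff)
  have "open W"
    unfolding W_def by (intro open_Collect_less continuous_intros)
  have XW: "X \<subseteq> W"
    using c by (auto simp: X_def W_def)
  then have "emeasure mu (X - E) \<le> emeasure mu W"
    using \<open>open W\<close> by (intro emeasure_mono) (auto simp: sets_mu)
  then have fin: "emeasure mu (X - E) \<noteq> \<infinity>"
    using finite_mu_away_from_A[of "c / 2"] c by (auto simp: W_def top_unique)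
  have "outer (X - E) < emeasure mu (X - E) + ennreal (e / 2)"
    using fin e XE by (simp add: emeasure_mu sets_mu ennreal_less_top)
  then obtain U where U: "open U" "X - E \<subseteq> U" "open_mass U < emeasure mu (X - E) + ennreal (e / 2)"
    by (rule outer_approx)
  have "emeasure mu (X - E) + emeasure mu (U - (X - E)) = emeasure mu U"
    using U XE by (subst plus_emeasure) (auto simp: sets_mu Un_absorb1)
  also have "\<dots> \<le> emeasure mu (X - E) + ennreal (e / 2)"
    using U(1,3) by (simp add: emeasure_mu_open)
  finally have Ue: "emeasure mu (U - (X - E)) \<le> ennreal (e / 2)"
    using fin by (simp add: ennreal_add_left_cancel_le)
  obtain K where K: "compact K" "K \<subseteq> - A" "emeasure mu (W - K) \<le> ennreal (e / 2)"
    unfolding W_def using compact_exhaustion[of "c / 2" "e / 2"] c e by auto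
  define C where "C = (X - U) \<inter> K"
  have C: "compact C"
    unfolding C_def using \<open>closed X\<close> U(1) K(1) by (intro closed_Int_compact closed_Diff)
  have meas: "C \<in> sets mu" "U - (X - E) \<in> sets mu" "W - K \<in> sets mu"
    using C U(1) XE \<open>open W\<close> K(1)
    by (auto simp: sets_mu borel_closed compact_imp_closed intro!: sets.Diff)
  \<comment> \<open>A point of \<open>E\<close> missed by \<open>C\<close> lies in \<open>U\<close>,
    hence in \<open>U - (X - E)\<close>, or outside \<open>K\<close>, hence in
    \<open>W - K\<close>.\<close>
  have "emeasure mu E \<le> emeasure mu (C \<union> ((U - (X - E)) \<union> (W - K)))"
    using meas E(2) XW by (intro emeasure_mono) (auto simp: C_def X_def)
  also have "\<dots> \<le> emeasure mu C + (emeasure mu (U - (X - E)) + emeasure mu (W - K))"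
    using meas by (intro order_trans[OF emeasure_subadditive] add_left_mono emeasure_subadditive) auto
  also have "\<dots> \<le> emeasure mu C + (ennreal (e / 2) + ennreal (e / 2))"
    by (intro add_mono order_refl Ue K)
  also have "\<dots> = emeasure mu C + ennreal e"
    using e by (simp flip: ennreal_plus)
  finally have "emeasure mu E \<le> emeasure mu C + ennreal e" .
  moreover have "C \<subseteq> E"
    using U(2) by (auto simp: C_def)
  ultimately show ?thesis
    using that C by blast
qed

text \<open>As \<open>A\<close> is closed, \<open>E\<close> is the increasing union of its parts at
  distance at least \<open>1 / (n + 1)\<close> from \<open>A\<close>. Each part has compact
  approximations, and continuity from below covers infinite mass too.\<close>

lemma mu_inner_regular:
  assumes E: "E \<in> sets borel" "E \<subseteq> - A"
  shows "emeasure mu E = (SUP K\<in>{K. compact K \<and> K \<subseteq> E}. emeasure mu K)"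
proof (rule antisym)
  show "(SUP K\<in>{K. compact K \<and> K \<subseteq> E}. emeasure mu K) \<le> emeasure mu E"
    using E(1) by (intro SUP_least emeasure_mono) (auto simp: sets_mu)
  define F where "F n = E \<inter> {x. inverse (real (Suc n)) \<le> infdist x A}" for n
  have Fb: "F n \<in> sets borel" for n
    unfolding F_def by (intro sets.Int E borel_closed closed_Collect_le continuous_intros)
  have "incseq F"
  proof (rule incseq_SucI)
    fix n
    have "inverse (real (Suc (Suc n))) \<le> inverse (real (Suc n))"
      by (intro le_imp_inverse_le) auto
    then show "F n \<subseteq> F (Suc n)"
      unfolding F_def using order_trans by blast
  qed
  moreover have "(\<Union>n. F n) = E"
  proof -
    have "\<exists>n. x \<in> F n" if x: "x \<in> E" for x
    proof -
      have "0 < infdist x A"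
        using E x closed nonempty by (intro infdist_pos_not_in_closed) auto
      then show ?thesis
        using x reals_Archimedean[of "infdist x A"] by (auto simp: F_def intro: less_imp_le)
    qed
    then show ?thesis
      by (auto simp: F_def)
  qed
  ultimately have eq: "(SUP n. emeasure mu (F n)) = emeasure mu E"
    using SUP_emeasure_incseq[of F mu] Fb by (auto simp: sets_mu)
  have "emeasure mu (F n) \<le> (SUP K\<in>{K. compact K \<and> K \<subseteq> E}. emeasure mu K)" for n
  proof (rule ennreal_le_epsilon)
    fix e :: real assume "0 < e"
    obtain K where K: "compact K" "K \<subseteq> F n" "emeasure mu (F n) \<le> emeasure mu K + ennreal e"
      using compact_approx[OF Fb, of n "inverse (real (Suc n))" e] \<open>0 < e\<close>
      by (auto simp: F_def)
    have "emeasure mu K \<le> (SUP K\<in>{K. compact K \<and> K \<subseteq> E}. emeasure mu K)"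
      using K by (intro SUP_upper) (auto simp: F_def)
    then show "emeasure mu (F n) \<le> (SUP K\<in>{K. compact K \<and> K \<subseteq> E}. emeasure mu K) + ennreal e"
      using K(3) by (meson add_right_mono order_trans)
  qed
  then show "emeasure mu E \<le> (SUP K\<in>{K. compact K \<and> K \<subseteq> E}. emeasure mu K)"
    unfolding eq[symmetric] by (rule SUP_least)
qed

section \<open>The class of \<open>mu\<close> as a relative Radon measure\<close>

definition rel_mu :: "'a measure set" where
  "rel_mu = rel_borel_equiv A `` {mu}"

lemma rel_mu: "rel_mu \<in> rel_borel_measures A" "mu \<in> rel_mu"
proof -
  have mu: "mu \<in> borel_measures"
    by (simp add: borel_measures_def sets_mu)
  show "rel_mu \<in> rel_borel_measures A"
    unfolding rel_mu_def rel_borel_measures_def using mu by (rule quotientI)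
  show "mu \<in> rel_mu"
    unfolding rel_mu_def using equiv_class_self[OF equiv_rel_borel_equiv[OF closed] mu] .
qed

lemma rel_integral_rel_mu: "f \<in> Lip A \<Longrightarrow> rel_integral rel_mu f = T f"
  using rel_integral_eq[OF closed rel_mu Lip_borel_measurable] integral_mu
  by (auto simp: Lip_def)

text \<open>Tightness is inner regularity of \<open>mu\<close>, since compact subsets of
  \<open>E\<close> miss \<open>A\<close>. Finiteness holds because the integral of
  \<open>infdist x A\<close> is the real number \<open>T\<close> assigns to it.\<close>

lemma rel_mu_M1_plus: "rel_mu \<in> M1_plus A"
proof -
  have "tight A rel_mu"
    unfolding tight_def
  proof (intro ballI impI)
    fix E assume E: "E \<in> sets (borel :: 'a measure)" "E \<subseteq> - A"
    have "rel_emeasure rel_mu K = emeasure mu K" if "compact K" "K \<subseteq> E" for K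
      using that E by (intro rel_emeasure_eq[OF closed rel_mu]) (auto simp: borel_compact)
    then show "rel_emeasure rel_mu E = (SUP K\<in>{K. compact K \<and> K \<subseteq> E}. rel_emeasure rel_mu K)"
      unfolding rel_emeasure_eq[OF closed rel_mu E] mu_inner_regular[OF E]
      by (intro SUP_cong) auto
  qed
  moreover have "one_finite A rel_mu"
  proof -
    have d: "(\<lambda>x. infdist x A) \<in> Lip A"
      by (rule Lip_infdist) simp
    have "rel_nn_integral rel_mu (\<lambda>x. ennreal (infdist x A)) = (\<integral>\<^sup>+x. ennreal (infdist x A) \<partial>mu)"
      using Lip_borel_measurable[OF d] by (intro rel_nn_integral_eq[OF closed rel_mu]) auto
    then show ?thesis
      unfolding one_finite_def by (simp add: nn_integral_mu[OF d infdist_nonneg])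
  qed
  ultimately show ?thesis
    using rel_mu(1) by (simp add: M1_plus_def)
qed

end

section \<open>Uniqueness and the representation theorem\<close>

text \<open>Off \<open>A\<close> the bumps increase to the indicator of \<open>U\<close>, so
  monotone convergence recovers the mass from integrals of functions in \<open>Lip A\<close>
  alone.\<close>

lemma emeasure_open_eq_SUP_bump:
  assumes A: "closed A" "A \<noteq> {}" and M: "M \<in> M1_plus A" "\<mu> \<in> M" and U: "open U" "U \<subseteq> - A"
  shows "emeasure \<mu> U = (SUP k. ennreal (rel_integral M (bump A U k)))"
proof -
  have Mr: "M \<in> rel_borel_measures A"
    using M(1) by (simp add: M1_plus_def)
  have s: "sets \<mu> = sets borel"
    using rel_borel_measures_agree(1)[OF A(1) Mr M(2,2)] by (simp add: borel_measures_def)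
  have b: "bump A U k \<in> Lip A" "\<And>x. 0 \<le> bump A U k x" for k
    using bump_Lip_plus[of A U k] by (auto simp: Lip_plus_def)
  have mono: "incseq (\<lambda>k x. ennreal (bump A U k x))"
    by (auto simp: incseq_def le_fun_def intro!: ennreal_leI bump_mono)
  have ind: "indicator U x = (SUP k. ennreal (bump A U k x))" for x
  proof (cases "x \<in> U")
    case True
    then have "(\<lambda>k. bump A U k x) \<longlonglongrightarrow> 1"
      using bump_eventually_1[OF A U(1) True] U(2) by (auto intro: tendsto_eventually)
    then have "(\<lambda>k. ennreal (bump A U k x)) \<longlonglongrightarrow> 1"
      using tendsto_ennrealI by fastforce
    moreover have "(\<lambda>k. ennreal (bump A U k x)) \<longlonglongrightarrow> (SUP k. ennreal (bump A U k x))"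
      using mono by (intro LIMSEQ_SUP) (auto simp: incseq_def le_fun_def)
    ultimately show ?thesis
      using True LIMSEQ_unique by fastforce
  next
    case False
    then have "bump A U k x = 0" for k
      using bump_le_indicator[of A U k x] b(2)[of k x] by simp
    then show ?thesis using False by simp
  qed
  have meas: "bump A U k \<in> borel_measurable \<mu>" for k
    using Lip_borel_measurable[OF b(1)] by (simp add: measurable_cong_sets[OF s refl])
  have "emeasure \<mu> U = (\<integral>\<^sup>+x. indicator U x \<partial>\<mu>)"
    using U(1) s by simp
  also have "\<dots> = (SUP k. \<integral>\<^sup>+x. ennreal (bump A U k x) \<partial>\<mu>)"
    unfolding ind using mono meas by (intro nn_integral_monotone_convergence_SUP) auto
  also have "\<dots> = (SUP k. ennreal (rel_integral M (bump A U k)))"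
  proof (intro SUP_cong refl)
    fix k
    have "(\<integral>\<^sup>+x. ennreal (bump A U k x) \<partial>\<mu>) = ennreal (\<integral>x. bump A U k x \<partial>\<mu>)"
      by (intro nn_integral_eq_integral Lip_integrable[OF A M b(1)] AE_I2 b(2))
    also have "(\<integral>x. bump A U k x \<partial>\<mu>) = rel_integral M (bump A U k)"
      using b(1)[of k] rel_integral_eq[OF A(1) Mr M(2) Lip_borel_measurable[OF b(1)], of k]
      by (auto simp: Lip_def)
    finally show "(\<integral>\<^sup>+x. ennreal (bump A U k x) \<partial>\<mu>) = ennreal (rel_integral M (bump A U k))" .
  qed
  finally show ?thesis .
qed

text \<open>Markov's inequality for the integrable function \<open>infdist x A\<close>.\<close>

lemma M1_plus_finite_away_from_A:
  assumes A: "closed A" "A \<noteq> {}" and M: "M \<in> M1_plus A" "\<mu> \<in> M" and c: "0 < c"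
  shows "emeasure \<mu> {x. c < infdist x A} \<noteq> \<infinity>"
proof -
  have Mr: "M \<in> rel_borel_measures A"
    using M(1) by (simp add: M1_plus_def)
  have s: "sets \<mu> = sets borel"
    using rel_borel_measures_agree(1)[OF A(1) Mr M(2,2)] by (simp add: borel_measures_def)
  have d: "(\<lambda>x. infdist x A) \<in> Lip A"
    by (rule Lip_infdist) simp
  let ?V = "{x. c < infdist x A}"
  have V: "?V \<in> sets \<mu>"
    using Lip_open_gt(1)[OF d] by (simp add: s)
  have "ennreal c * emeasure \<mu> ?V = (\<integral>\<^sup>+x. ennreal c * indicator ?V x \<partial>\<mu>)"
    using V by (simp add: nn_integral_cmult_indicator)
  also have "\<dots> \<le> (\<integral>\<^sup>+x. ennreal (infdist x A) \<partial>\<mu>)"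
    by (intro nn_integral_mono) (auto simp: indicator_def intro!: ennreal_leI)
  also have "\<dots> = ennreal (\<integral>x. infdist x A \<partial>\<mu>)"
    by (intro nn_integral_eq_integral Lip_integrable[OF A M d] AE_I2 infdist_nonneg)
  finally have "ennreal c * emeasure \<mu> ?V < \<infinity>"
    by (rule order.strict_trans1) simp
  then show ?thesis
    using c by (auto simp: ennreal_mult_eq_top_iff)
qed

lemma compact_disjoint_closed_infdist:
  assumes "compact K" "K \<subseteq> - A" "closed A" "A \<noteq> {}"
  obtains c where "0 < c" "K \<subseteq> {x. c < infdist x A}"
proof (cases "K = {}")
  case True
  then show ?thesis using that[of 1] by simp
next
  case False
  have "continuous_on K (\<lambda>x. infdist x A)"
    by (intro continuous_intros)
  then obtain y where y: "y \<in> K" "\<And>x. x \<in> K \<Longrightarrow> infdist y A \<le> infdist x A"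
    using continuous_attains_inf[OF assms(1) False] by blast
  have "0 < infdist y A"
    using y assms by (intro infdist_pos_not_in_closed) auto
  \<comment> \<open>Half of the attained minimum makes the inequality strict on all of
    \<open>K\<close>.\<close>
  moreover have "K \<subseteq> {x. infdist y A / 2 < infdist x A}"
    using y(2) \<open>0 < infdist y A\<close> by force
  ultimately show ?thesis
    using that[of "infdist y A / 2"] by simp
qed

lemma M1_plus_unique:
  assumes A: "closed A" "A \<noteq> {}" and M: "M \<in> M1_plus A" and N: "N \<in> M1_plus A"
    and eq: "\<And>f. f \<in> Lip A \<Longrightarrow> rel_integral M f = rel_integral N f"
  shows "M = N"
proof -
  have Mr: "M \<in> rel_borel_measures A" "N \<in> rel_borel_measures A"
    using M N by (auto simp: M1_plus_def)
  note equiv = equiv_rel_borel_equiv[OF A(1)]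
  obtain \<mu> \<nu> where \<mu>: "\<mu> \<in> M" and \<nu>: "\<nu> \<in> N"
    using in_quotient_imp_non_empty[OF equiv] Mr unfolding rel_borel_measures_def by blast
  have b: "\<mu> \<in> borel_measures" "\<nu> \<in> borel_measures"
    using rel_borel_measures_agree(1)[OF A(1) Mr(1) \<mu> \<mu>]
      rel_borel_measures_agree(1)[OF A(1) Mr(2) \<nu> \<nu>] by auto
  have opn: "emeasure \<mu> U = emeasure \<nu> U" if "open U" "U \<subseteq> - A" for U
    unfolding emeasure_open_eq_SUP_bump[OF A M \<mu> that] emeasure_open_eq_SUP_bump[OF A N \<nu> that]
    using bump_Lip_plus[of A U] by (simp add: eq Lip_plus_def)
  have cmp: "emeasure \<mu> K = emeasure \<nu> K" if K: "compact K" "K \<subseteq> - A" for K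
  proof -
    obtain c where c: "0 < c" "K \<subseteq> {x. c < infdist x A}"
      using compact_disjoint_closed_infdist[OF K A] .
    define V where "V = {x. c < infdist x A}"
    have V: "open V" "V \<subseteq> - A" "K \<subseteq> V"
      using c by (auto simp: V_def intro!: open_Collect_less continuous_intros)
    have VK: "open (V - K)" "V - K \<subseteq> - A"
      using V K(1) by (auto intro: open_Diff compact_imp_closed)
    have "emeasure \<rho> K + emeasure \<rho> (V - K) = emeasure \<rho> V" if "\<rho> \<in> borel_measures" for \<rho>
      using that V VK K(1)
      by (subst plus_emeasure) (auto simp: borel_measures_def borel_compact Un_absorb1)
    \<comment> \<open>\<open>V\<close> and \<open>V - K\<close> are open, so the two measures agree
      on them. Cancelling \<open>V - K\<close> is legitimate because \<open>V\<close> keeps a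
      positive distance from \<open>A\<close> and has finite mass.\<close>
    then have "emeasure \<mu> (V - K) + emeasure \<mu> K = emeasure \<mu> (V - K) + emeasure \<nu> K"
      using b opn[OF V(1,2)] opn[OF VK] by (metis add.commute)
    moreover have "emeasure \<mu> (V - K) \<noteq> \<infinity>"
    proof -
      have "emeasure \<mu> (V - K) \<le> emeasure \<mu> V"
        using V(1) b(1) by (intro emeasure_mono) (auto simp: borel_measures_def)
      then show ?thesis
        using M1_plus_finite_away_from_A[OF A M \<mu> c(1)] by (auto simp: V_def top_unique)
    qed
    ultimately show ?thesis
      by (simp add: ennreal_add_left_cancel)
  qed
  have "emeasure \<mu> E = emeasure \<nu> E" if E: "E \<in> sets borel" "E \<subseteq> - A" for E
  proof -
    have "rel_emeasure M K = rel_emeasure N K" if K: "compact K" "K \<subseteq> E" for K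
    proof -
      have "K \<in> sets borel" "K \<subseteq> - A"
        using K E by (auto simp: borel_compact)
      then show ?thesis
        using cmp[OF K(1)] rel_emeasure_eq[OF A(1) Mr(1) \<mu>] rel_emeasure_eq[OF A(1) Mr(2) \<nu>]
        by simp
    qed
    then have "(SUP K\<in>{K. compact K \<and> K \<subseteq> E}. rel_emeasure M K)
        = (SUP K\<in>{K. compact K \<and> K \<subseteq> E}. rel_emeasure N K)"
      by (intro SUP_cong) auto
    then have "rel_emeasure M E = rel_emeasure N E"
      using M N E unfolding M1_plus_def tight_def by simp
    then show ?thesis
      by (simp add: rel_emeasure_eq[OF A(1) Mr(1) \<mu> E] rel_emeasure_eq[OF A(1) Mr(2) \<nu> E])
  qed
  then have "(\<mu>, \<nu>) \<in> rel_borel_equiv A"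
    using b by (auto simp: rel_borel_equiv_iff[OF A(1)])
  then show ?thesis
    using quotient_eq_iff[OF equiv, of M N \<mu> \<nu>] Mr \<mu> \<nu> unfolding rel_borel_measures_def by blast
qed

theorem theorem1p3:
  fixes A :: "'a::metric_space set" and T :: "('a \<Rightarrow> real) \<Rightarrow> real"
  assumes "closed A"
    and "A \<noteq> {}"
    and "positive_linear_functional A T"
    and "seq_order_continuous (Lip A) T"
    and "exhausted_by_compacts A T"
  shows "\<exists>!M. M \<in> M1_plus A \<and> (\<forall>f\<in>Lip A. T f = rel_integral M f)"
proof -
  interpret exhausted_lipschitz_integral A T
    using assms by unfold_locales
  show ?thesis
  proof (rule ex1I[of _ rel_mu])
    show "rel_mu \<in> M1_plus A \<and> (\<forall>f\<in>Lip A. T f = rel_integral rel_mu f)"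
      by (simp add: rel_mu_M1_plus rel_integral_rel_mu)
    show "M = rel_mu" if "M \<in> M1_plus A \<and> (\<forall>f\<in>Lip A. T f = rel_integral M f)" for M
      using that rel_mu_M1_plus rel_integral_rel_mu
      by (intro M1_plus_unique[OF assms(1,2)]) auto
  qed
qed

end
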